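(* Let $1<p<\infty$, $n\ge 2$, let $\Omega\subseteq\mathbb{R}^n$ be a domain, and let $a=(a_1,\dots,a_n)$ be a weight vector as in the context. Then there exist constants $0<c\le C<\infty$ depending only on $p$ such that for almost all $x\in\Omega$ and all $\xi,\eta\in\mathbb{R}^n$, $$c\sum_{i=1}^{n}|\eta_i'|^2\left(|\eta_i'|+|\xi_i'|\right)^{p-2}\le |\xi+\eta|_{p,a}^{p}-|\xi|_{p,a}^{p}-p\sum_{i=1}^{n}a_i(x)|\xi_i|^{p-2}\xi_i\eta_i\le C\sum_{i=1}^{n}|\eta_i'|^2\left(|\eta_i'|+|\xi_i'|\right)^{p-2}.$$
   Context: The functions $a_1,\dots,a_n:\Omega\to(0,\infty)$ are Lebesgue measurable and locally equivalent to $1$: for every domain $\omega$ whose closure is a compact subset of $\Omega$ there are constants $0<c_\omega\le C_\omega<\infty$ with $c_\omega\le a_i\le C_\omega$ a.e. in $\omega$. For almost all $x\in\Omega$ and $\xi\in\mathbb{R}^n$, $|\xi|_{p,a}^p=\sum_{i=1}^n a_i(x)|\xi_i|^p$, and $\xi_i'=a_i(x)^{1/p}\xi_i$ (similarly $\eta_i'=a_i(x)^{1/p}\eta_i$). Conventions: $|t|^{p-2}t=0$ for $t=0$, and $t^2(t+\tau)^{p-2}=0$ when $t=\tau=0$. *)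

theory Defs
  imports "HOL-Analysis.Analysis"
begin

text \<open>
  The constants in the theorem depend on neither the weights, the domain nor the dimension, so \<open>n\<close>
  has to be quantified inside the existential quantifier and cannot be the cardinality of a type.
  Hence \<open>\<real>\<^sup>n\<close> is the set of extensional functions on \<open>{1..n}\<close>, with the product topology and the
  completed product of one-dimensional Lebesgue measures, all of which share this carrier.
\<close>

definition Rn :: "nat \<Rightarrow> (nat \<Rightarrow> real) set" where
  "Rn n = (\<Pi>\<^sub>E i\<in>{1..n}. UNIV)"

definition Rn_top :: "nat \<Rightarrow> (nat \<Rightarrow> real) topology" where
  "Rn_top n = product_topology (\<lambda>_. euclideanreal) {1..n}"

definition Rn_lebesgue :: "nat \<Rightarrow> (nat \<Rightarrow> real) measure" where
  "Rn_lebesgue n = completion (\<Pi>\<^sub>M i\<in>{1..n}. lborel)"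

lemma topspace_Rn_top: "topspace (Rn_top n) = Rn n"
  by (simp add: Rn_top_def Rn_def)

lemma space_Rn_lebesgue: "space (Rn_lebesgue n) = Rn n"
  by (simp add: Rn_lebesgue_def Rn_def space_PiM)

definition is_domain :: "nat \<Rightarrow> (nat \<Rightarrow> real) set \<Rightarrow> bool" where
  "is_domain n \<Omega> \<longleftrightarrow> \<Omega> \<noteq> {} \<and> openin (Rn_top n) \<Omega> \<and> connectedin (Rn_top n) \<Omega>"

definition weight_vector ::
  "nat \<Rightarrow> (nat \<Rightarrow> real) set \<Rightarrow> (nat \<Rightarrow> (nat \<Rightarrow> real) \<Rightarrow> real) \<Rightarrow> bool" where
  "weight_vector n \<Omega> a \<longleftrightarrow>
     (\<forall>i\<in>{1..n}. a i \<in> borel_measurable (restrict_space (Rn_lebesgue n) \<Omega>) \<and>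
                 (\<forall>x\<in>\<Omega>. 0 < a i x)) \<and>
     (\<forall>\<omega>. is_domain n \<omega> \<and> compactin (Rn_top n) (Rn_top n closure_of \<omega>) \<and>
           Rn_top n closure_of \<omega> \<subseteq> \<Omega> \<longrightarrow>
       (\<exists>c C::real. 0 < c \<and> c \<le> C \<and>
          (\<forall>i\<in>{1..n}. AE x in Rn_lebesgue n. x \<in> \<omega> \<longrightarrow> c \<le> a i x \<and> a i x \<le> C)))"

text \<open>The \<open>p\<close>-th power \<open>|\<xi>|\<^sub>p\<^sub>,\<^sub>a\<^sup>p\<close>, at the point \<open>x\<close>.\<close>

definition pa_norm_pow ::
  "nat \<Rightarrow> real \<Rightarrow> (nat \<Rightarrow> (nat \<Rightarrow> real) \<Rightarrow> real) \<Rightarrow> (nat \<Rightarrow> real) \<Rightarrow> (nat \<Rightarrow> real) \<Rightarrow> real" where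
  "pa_norm_pow n p a x \<xi> = (\<Sum>i=1..n. a i x * \<bar>\<xi> i\<bar> powr p)"

text \<open>The component \<open>\<xi>\<^sub>i' = a\<^sub>i(x)\<^bsup>1/p\<^esup> \<xi>\<^sub>i\<close>.\<close>

definition scaled ::
  "real \<Rightarrow> (nat \<Rightarrow> (nat \<Rightarrow> real) \<Rightarrow> real) \<Rightarrow> (nat \<Rightarrow> real) \<Rightarrow> (nat \<Rightarrow> real) \<Rightarrow> nat \<Rightarrow> real" where
  "scaled p a x \<xi> i = a i x powr (1 / p) * \<xi> i"

definition vadd :: "nat \<Rightarrow> (nat \<Rightarrow> real) \<Rightarrow> (nat \<Rightarrow> real) \<Rightarrow> nat \<Rightarrow> real" where
  "vadd n \<xi> \<eta> = (\<lambda>i\<in>{1..n}. \<xi> i + \<eta> i)"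

text \<open>
  Since \<open>0 powr s = 0\<close> for every \<open>s\<close>, the formula below and \<open>\<bar>t\<bar> powr (p - 2) * t\<close> take the value
  \<open>0\<close> at \<open>t = \<tau> = 0\<close> and \<open>t = 0\<close>, as the usual conventions for \<open>p < 2\<close> require.
\<close>

definition quasi_sum ::
  "nat \<Rightarrow> real \<Rightarrow> (nat \<Rightarrow> (nat \<Rightarrow> real) \<Rightarrow> real) \<Rightarrow> (nat \<Rightarrow> real) \<Rightarrow> (nat \<Rightarrow> real) \<Rightarrow> (nat \<Rightarrow> real) \<Rightarrow> real"
  where
  "quasi_sum n p a x \<xi> \<eta> =
     (\<Sum>i=1..n. \<bar>scaled p a x \<eta> i\<bar>\<^sup>2 * (\<bar>scaled p a x \<eta> i\<bar> + \<bar>scaled p a x \<xi> i\<bar>) powr (p - 2))"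

end

theory Submission
  imports Defs "HOL-Real_Asymp.Real_Asymp"
begin

text \<open>
  Everything is a sum over coordinates, and the components \<open>\<xi>\<^sub>i'\<close> absorb the weights, so a scalar
  inequality for \<open>\<bar>s + t\<bar>\<^sup>p - \<bar>s\<bar>\<^sup>p - p \<bar>s\<bar>\<^bsup>p-2\<^esup> s t\<close> suffices. By homogeneity one may take \<open>s = 1\<close>.
  The quotient of the two sides is then a positive continuous function of \<open>t \<noteq> 0\<close> with limits
  \<open>p (p - 1) / 2\<close> at \<open>0\<close> and \<open>1\<close> at \<open>\<plusminus>\<infinity>\<close>, hence it is bounded above and away from \<open>0\<close>.
\<close>

text \<open>The limits control \<open>h\<close> outside a compact interval, and the extreme value
  theorem controls it inside. Positivity of \<open>L\<close> and \<open>M\<close> keeps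
  \<open>h\<close> from decaying to 0 at infinity.\<close>

lemma pos_continuous_bounds:
  fixes h :: "real \<Rightarrow> real"
  assumes cont: "continuous_on UNIV h" and pos: "\<And>u. 0 < h u"
    and top: "(h \<longlongrightarrow> L) at_top" and bot: "(h \<longlongrightarrow> M) at_bot" and L: "0 < L" and M: "0 < M"
  obtains c C where "0 < c" "\<And>u. c \<le> h u" "\<And>u. h u \<le> C"
proof -
  have "eventually (\<lambda>u. L / 2 < h u \<and> h u < L + 1) at_top"
    using order_tendstoD[OF top, of "L / 2"] order_tendstoD[OF top, of "L + 1"] L
    by (auto intro: eventually_conj)
  then obtain A where A: "\<And>u. A \<le> u \<Longrightarrow> L / 2 < h u \<and> h u < L + 1"
    by (auto simp: eventually_at_top_linorder)
  have "eventually (\<lambda>u. M / 2 < h u \<and> h u < M + 1) at_bot"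
    using order_tendstoD[OF bot, of "M / 2"] order_tendstoD[OF bot, of "M + 1"] M
    by (auto intro: eventually_conj)
  then obtain B where B: "\<And>u. u \<le> B \<Longrightarrow> M / 2 < h u \<and> h u < M + 1"
    by (auto simp: eventually_at_bot_linorder)
  \<comment> \<open>The order of \<open>A\<close> and \<open>B\<close> is unknown; with
    \<open>min\<close> and \<open>max\<close> the interval is nonempty, and a point outside it lies
    above \<open>A\<close> or below \<open>B\<close>.\<close>
  define S where "S = {min A B..max A B}"
  have S: "compact S" "S \<noteq> {}" "continuous_on S h"
    using cont by (auto simp: S_def intro: continuous_on_subset)
  obtain y where y: "\<And>u. u \<in> S \<Longrightarrow> h y \<le> h u"
    using continuous_attains_inf[OF S] by blast
  obtain z where z: "\<And>u. u \<in> S \<Longrightarrow> h u \<le> h z"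
    using continuous_attains_sup[OF S] by blast
  have cases: "u \<in> S \<or> A \<le> u \<or> u \<le> B" for u
    by (auto simp: S_def)
  show thesis
  proof
    show "0 < min (h y) (min (L / 2) (M / 2))"
      using pos L M by simp
    show "min (h y) (min (L / 2) (M / 2)) \<le> h u" for u
      using cases[of u] y[of u] A[of u] B[of u] by (auto simp: min_le_iff_disj)
    show "h u \<le> max (h z) (max (L + 1) (M + 1))" for u
      using cases[of u] z[of u] A[of u] B[of u] by (auto simp: le_max_iff_disj)
  qed
qed

text \<open>Strict convexity: the graph of the p-th power of the absolute value lies strictly above
  its tangent at 1. For \<open>u > -1\<close> this is the mean value theorem together with the
  strict growth of the derivative.\<close>

lemma powr_remainder_pos:
  fixes p u :: real
  assumes p: "1 < p" and u: "u \<noteq> 0"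
  shows "0 < \<bar>1 + u\<bar> powr p - 1 - p * u"
proof (cases "-1 < u")
  case True
  have D: "((\<lambda>x. x powr p) has_real_derivative p * x powr (p - 1)) (at x)" if "0 < x" for x
    using that by (auto intro!: derivative_eq_intros)
  show ?thesis
  proof (cases "0 < u")
    case True
    obtain z where z: "1 < z" "z < 1 + u"
      and eq: "(1 + u) powr p - 1 powr p = (1 + u - 1) * (p * z powr (p - 1))"
      using MVT2[of 1 "1 + u" "\<lambda>x. x powr p" "\<lambda>x. p * x powr (p - 1)"] D True by force
    have "1 < z powr (p - 1)"
      using z p by simp
    then have "u * p * 1 < u * p * z powr (p - 1)"
      using True p by (intro mult_strict_left_mono) auto
    with eq True show ?thesis by (simp add: algebra_simps)
  next
    case False
    then have u: "u < 0" using u by simp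
    obtain z where z: "1 + u < z" "z < 1"
      and eq: "1 powr p - (1 + u) powr p = (1 - (1 + u)) * (p * z powr (p - 1))"
      using MVT2[of "1 + u" 1 "\<lambda>x. x powr p" "\<lambda>x. p * x powr (p - 1)"] D \<open>-1 < u\<close> u by force
    have "z powr (p - 1) < 1 powr (p - 1)"
      using z p \<open>-1 < u\<close> by (intro powr_less_mono2) auto
    then have "- u * p * z powr (p - 1) < - u * p * 1"
      using u p by (intro mult_strict_left_mono) (auto simp: mult_less_0_iff)
    with eq \<open>-1 < u\<close> show ?thesis by (simp add: algebra_simps)
  qed
next
  case False
  \<comment> \<open>For \<open>u <= -1\<close> the tangent value \<open>1 + p * u\<close> is at most
    \<open>1 - p < 0\<close>, while the power is nonnegative.\<close>
  then have "p * 1 \<le> p * (- u)" using p by (intro mult_left_mono) auto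
  then have "0 < - 1 - p * u" using p by simp
  then show ?thesis by (smt (verit) powr_ge_zero)
qed

lemma powr_remainder_bounds_at_1:
  fixes p :: real
  assumes p: "1 < p"
  obtains c C where "0 < c"
    "\<And>u. c * (u\<^sup>2 * (1 + \<bar>u\<bar>) powr (p - 2)) \<le> \<bar>1 + u\<bar> powr p - 1 - p * u"
    "\<And>u. \<bar>1 + u\<bar> powr p - 1 - p * u \<le> C * (u\<^sup>2 * (1 + \<bar>u\<bar>) powr (p - 2))"
proof -
  define f where "f u = \<bar>1 + u\<bar> powr p - 1 - p * u" for u :: real
  define g where "g u = u\<^sup>2 * (1 + \<bar>u\<bar>) powr (p - 2)" for u :: real
  \<comment> \<open>The value at 0 comes from the second-order Taylor expansion: \<open>f u\<close>
    behaves like \<open>p * (p - 1) / 2 * u^2\<close> and \<open>g u\<close> like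
    \<open>u^2\<close>.\<close>
  define h where "h u = (if u = 0 then p * (p - 1) / 2 else f u / g u)" for u
  have g_pos: "0 < g u" if "u \<noteq> 0" for u
    using that by (auto simp: g_def intro!: mult_pos_pos)
  have h_pos: "0 < h u" for u
    using powr_remainder_pos[OF p, of u] g_pos[of u] p by (auto simp: h_def f_def)
  \<comment> \<open>Numerator and denominator both grow like \<open>u powr p\<close>, since
    \<open>p > 1\<close> makes the linear term negligible. In each of the four limits the absolute
    values are first resolved by the sign of their arguments.\<close>
  have top: "(h \<longlongrightarrow> 1) at_top"
  proof (rule Lim_transform_eventually)
    show "((\<lambda>u. ((1 + u) powr p - 1 - p * u) / (u\<^sup>2 * (1 + u) powr (p - 2))) \<longlongrightarrow> 1) at_top"
      using p by real_asymp
    show "eventually (\<lambda>u. ((1 + u) powr p - 1 - p * u) / (u\<^sup>2 * (1 + u) powr (p - 2)) = h u) at_top"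
      using eventually_gt_at_top[of 0] by eventually_elim (auto simp: h_def f_def g_def)
  qed
  have bot: "(h \<longlongrightarrow> 1) at_bot"
  proof (rule Lim_transform_eventually)
    show "((\<lambda>u. ((- 1 - u) powr p - 1 - p * u) / (u\<^sup>2 * (1 - u) powr (p - 2))) \<longlongrightarrow> 1) at_bot"
      using p by real_asymp
    show "eventually (\<lambda>u. ((- 1 - u) powr p - 1 - p * u) / (u\<^sup>2 * (1 - u) powr (p - 2)) = h u) at_bot"
      using eventually_le_at_bot[of "-1"] by eventually_elim (auto simp: h_def f_def g_def)
  qed
  have right: "(h \<longlongrightarrow> p * (p - 1) / 2) (at_right 0)"
  proof (rule Lim_transform_eventually)
    show "((\<lambda>u. ((1 + u) powr p - 1 - p * u) / (u\<^sup>2 * (1 + u) powr (p - 2))) \<longlongrightarrow> p * (p - 1) / 2) (at_right 0)"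
      using p by (real_asymp simp: field_simps)
    show "eventually (\<lambda>u. ((1 + u) powr p - 1 - p * u) / (u\<^sup>2 * (1 + u) powr (p - 2)) = h u) (at_right 0)"
      using eventually_at_right_less[of 0] by eventually_elim (auto simp: h_def f_def g_def)
  qed
  have left: "(h \<longlongrightarrow> p * (p - 1) / 2) (at_left 0)"
  proof (rule Lim_transform_eventually)
    show "((\<lambda>u. ((1 + u) powr p - 1 - p * u) / (u\<^sup>2 * (1 - u) powr (p - 2))) \<longlongrightarrow> p * (p - 1) / 2) (at_left 0)"
      using p by (real_asymp simp: field_simps)
    have "eventually (\<lambda>u::real. u \<in> {-1<..<0}) (at_left 0)"
      by (rule eventually_at_left_real) simp
    then show "eventually (\<lambda>u. ((1 + u) powr p - 1 - p * u) / (u\<^sup>2 * (1 - u) powr (p - 2)) = h u) (at_left 0)"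
      by eventually_elim (auto simp: h_def f_def g_def)
  qed
  have "isCont h u" for u
  proof (cases "u = 0")
    case True
    have "(h \<longlongrightarrow> h 0) (at 0)"
      using left right by (auto simp: filterlim_split_at h_def)
    with True show ?thesis by (simp add: isCont_def)
  next
    case False
    have "isCont f u"
      \<comment> \<open>At \<open>u = -1\<close> the base of the power vanishes, so continuity there
        rests on a nonnegative base and a positive exponent.\<close>
      unfolding isCont_def f_def using p
      by (intro tendsto_diff tendsto_powr2 tendsto_rabs tendsto_add tendsto_mult tendsto_const
          tendsto_ident_at) auto
    moreover have "isCont g u"
      unfolding g_def by (intro continuous_intros) auto
    ultimately have "isCont (\<lambda>u. f u / g u) u"
      using g_pos[OF False] by (intro continuous_intros) auto
    moreover have "eventually (\<lambda>v. f v / g v = h v) (nhds u)"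
      using t1_space_nhds[OF False] by eventually_elim (simp add: h_def)
    ultimately show ?thesis using isCont_cong[of "\<lambda>v. f v / g v" h u] by simp
  qed
  then have "continuous_on UNIV h"
    by (simp add: continuous_at_imp_continuous_on)
  then obtain c C where cC: "0 < c" "\<And>u. c \<le> h u" "\<And>u. h u \<le> C"
    using pos_continuous_bounds[of h 1 1, OF _ h_pos top bot] by auto
  \<comment> \<open>At \<open>u = 0\<close> both \<open>f\<close> and \<open>g\<close> vanish, so
    the value chosen for \<open>h 0\<close> does not matter here.\<close>
  have f_eq: "f u = h u * g u" for u
    using g_pos[of u] by (auto simp: h_def f_def g_def)
  have "0 \<le> g u" for u
    by (simp add: g_def)
  then have "c * g u \<le> f u" "f u \<le> C * g u" for u
    using cC by (simp_all add: f_eq mult_right_mono)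
  with cC(1) show thesis
    unfolding f_def g_def by (rule that)
qed

text \<open>Both sides are homogeneous of degree \<open>p\<close> in \<open>(s, t)\<close>, so for
  \<open>s\<close> nonzero, factoring out the p-th power of \<open>abs s\<close> reduces to the case
  \<open>s = 1\<close> with \<open>u = t / s\<close>. For \<open>s = 0\<close> both expressions
  equal the p-th power of \<open>abs t\<close>.\<close>

lemma powr_remainder_bounds:
  fixes p :: real
  assumes p: "1 < p"
  obtains c C where "0 < c" "c \<le> C"
    "\<And>s t. c * (\<bar>t\<bar>\<^sup>2 * (\<bar>t\<bar> + \<bar>s\<bar>) powr (p - 2))
        \<le> \<bar>s + t\<bar> powr p - \<bar>s\<bar> powr p - p * (\<bar>s\<bar> powr (p - 2) * s * t)"
    "\<And>s t. \<bar>s + t\<bar> powr p - \<bar>s\<bar> powr p - p * (\<bar>s\<bar> powr (p - 2) * s * t)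
        \<le> C * (\<bar>t\<bar>\<^sup>2 * (\<bar>t\<bar> + \<bar>s\<bar>) powr (p - 2))"
proof -
  obtain c0 C0 where c0: "0 < c0"
    "\<And>u. c0 * (u\<^sup>2 * (1 + \<bar>u\<bar>) powr (p - 2)) \<le> \<bar>1 + u\<bar> powr p - 1 - p * u"
    "\<And>u. \<bar>1 + u\<bar> powr p - 1 - p * u \<le> C0 * (u\<^sup>2 * (1 + \<bar>u\<bar>) powr (p - 2))"
    using powr_remainder_bounds_at_1[OF p] by metis
  define R where "R s t = \<bar>s + t\<bar> powr p - \<bar>s\<bar> powr p - p * (\<bar>s\<bar> powr (p - 2) * s * t)" for s t
  define Q where "Q s t = \<bar>t\<bar>\<^sup>2 * (\<bar>t\<bar> + \<bar>s\<bar>) powr (p - 2)" for s t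
  \<comment> \<open>This includes \<open>r = 0\<close>, where \<open>0 powr p = 0\<close> makes both
    sides vanish.\<close>
  have sq: "\<bar>r\<bar>\<^sup>2 * \<bar>r\<bar> powr (p - 2) = \<bar>r\<bar> powr p" for r :: real
    by (cases "r = 0") (simp_all add: powr_diff)
  have zero: "R 0 t = Q 0 t" for t
    using sq[of t] by (simp add: R_def Q_def)
  have scale: "R s t = \<bar>s\<bar> powr p * (\<bar>1 + t / s\<bar> powr p - 1 - p * (t / s))"
    "Q s t = \<bar>s\<bar> powr p * ((t / s)\<^sup>2 * (1 + \<bar>t / s\<bar>) powr (p - 2))" if s: "s \<noteq> 0" for s t
  proof -
    have 1: "\<bar>s + t\<bar> = \<bar>s\<bar> * \<bar>1 + t / s\<bar>"
      using s by (simp add: abs_mult[symmetric] field_simps)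
    have 2: "\<bar>t\<bar> + \<bar>s\<bar> = \<bar>s\<bar> * (1 + \<bar>t / s\<bar>)"
      using s by (simp add: field_simps)
    have 3: "\<bar>s\<bar> powr (p - 2) * s * t = \<bar>s\<bar> powr p * (t / s)"
      using s by (simp add: sq[of s, symmetric] power2_eq_square field_simps)
    have 4: "\<bar>t\<bar>\<^sup>2 = \<bar>s\<bar>\<^sup>2 * (t / s)\<^sup>2"
      using s by (simp add: power_divide)
    show "R s t = \<bar>s\<bar> powr p * (\<bar>1 + t / s\<bar> powr p - 1 - p * (t / s))"
      unfolding R_def 1 3 by (simp add: powr_mult algebra_simps)
    show "Q s t = \<bar>s\<bar> powr p * ((t / s)\<^sup>2 * (1 + \<bar>t / s\<bar>) powr (p - 2))"
      unfolding Q_def 2 4 sq[of s, symmetric] powr_mult by simp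
  qed
  have Q_nonneg: "0 \<le> Q s t" for s t
    by (simp add: Q_def)
  \<comment> \<open>Comparing with 1 covers \<open>s = 0\<close>, where the ratio of
    \<open>R\<close> to \<open>Q\<close> is exactly 1 for \<open>t\<close> nonzero, and also yields
    \<open>c <= C\<close>.\<close>
  define c where "c = min c0 1"
  define C where "C = max C0 1"
  have "c * Q s t \<le> R s t \<and> R s t \<le> C * Q s t" for s t
  proof -
    consider "s = 0" | "c0 * Q s t \<le> R s t" "R s t \<le> C0 * Q s t"
      using mult_left_mono[OF c0(2)[of "t / s"], of "\<bar>s\<bar> powr p"]
        mult_left_mono[OF c0(3)[of "t / s"], of "\<bar>s\<bar> powr p"] scale[of s t]
      by (cases "s = 0") (auto simp: mult.left_commute)
    then show ?thesis
    proof cases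
      case 1
      then show ?thesis
        using zero[of t] mult_right_mono[of c 1 "Q s t"] mult_right_mono[of 1 C "Q s t"] Q_nonneg[of s t]
        by (simp add: c_def C_def)
    next
      case 2
      moreover have "c * Q s t \<le> c0 * Q s t" "C0 * Q s t \<le> C * Q s t"
        using Q_nonneg by (auto simp: c_def C_def intro!: mult_right_mono)
      ultimately show ?thesis by linarith
    qed
  qed
  then show thesis
    using c0(1) by (intro that[of c C]) (auto simp: R_def Q_def c_def C_def)
qed

theorem lemma3p7:
  fixes p :: real
  assumes "1 < p"
  shows "\<exists>c C :: real. 0 < c \<and> c \<le> C \<and>
    (\<forall>(n::nat) (\<Omega> :: (nat \<Rightarrow> real) set) (a :: nat \<Rightarrow> (nat \<Rightarrow> real) \<Rightarrow> real).
       2 \<le> n \<longrightarrow> is_domain n \<Omega> \<longrightarrow> weight_vector n \<Omega> a \<longrightarrow>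
       (AE x in Rn_lebesgue n. x \<in> \<Omega> \<longrightarrow>
          (\<forall>\<xi>\<in>Rn n. \<forall>\<eta>\<in>Rn n.
             c * quasi_sum n p a x \<xi> \<eta>
               \<le> pa_norm_pow n p a x (vadd n \<xi> \<eta>) - pa_norm_pow n p a x \<xi>
                   - p * (\<Sum>i=1..n. a i x * \<bar>\<xi> i\<bar> powr (p - 2) * \<xi> i * \<eta> i) \<and>
             pa_norm_pow n p a x (vadd n \<xi> \<eta>) - pa_norm_pow n p a x \<xi>
                   - p * (\<Sum>i=1..n. a i x * \<bar>\<xi> i\<bar> powr (p - 2) * \<xi> i * \<eta> i)
               \<le> C * quasi_sum n p a x \<xi> \<eta>)))"
proof -
  obtain c C where cC: "0 < c" "c \<le> C"
    and lower: "\<And>s t. c * (\<bar>t\<bar>\<^sup>2 * (\<bar>t\<bar> + \<bar>s\<bar>) powr (p - 2))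
        \<le> \<bar>s + t\<bar> powr p - \<bar>s\<bar> powr p - p * (\<bar>s\<bar> powr (p - 2) * s * t)"
    and upper: "\<And>s t. \<bar>s + t\<bar> powr p - \<bar>s\<bar> powr p - p * (\<bar>s\<bar> powr (p - 2) * s * t)
        \<le> C * (\<bar>t\<bar>\<^sup>2 * (\<bar>t\<bar> + \<bar>s\<bar>) powr (p - 2))"
    using powr_remainder_bounds[OF assms] by metis
  \<comment> \<open>The constants are fixed before \<open>n\<close>, the domain and the weights, so
    they depend only on \<open>p\<close>. The estimate is shown at every point of the domain, where
    the weights are positive, and the almost-everywhere statement follows.\<close>
  have "c * quasi_sum n p a x \<xi> \<eta>
        \<le> pa_norm_pow n p a x (vadd n \<xi> \<eta>) - pa_norm_pow n p a x \<xi>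
            - p * (\<Sum>i=1..n. a i x * \<bar>\<xi> i\<bar> powr (p - 2) * \<xi> i * \<eta> i) \<and>
      pa_norm_pow n p a x (vadd n \<xi> \<eta>) - pa_norm_pow n p a x \<xi>
            - p * (\<Sum>i=1..n. a i x * \<bar>\<xi> i\<bar> powr (p - 2) * \<xi> i * \<eta> i)
        \<le> C * quasi_sum n p a x \<xi> \<eta>"
    if w: "weight_vector n \<Omega> a" and x: "x \<in> \<Omega>" for n \<Omega> a x \<xi> \<eta>
  proof -
    define R where "R s t = \<bar>s + t\<bar> powr p - \<bar>s\<bar> powr p - p * (\<bar>s\<bar> powr (p - 2) * s * t)" for s t
    \<comment> \<open>The weight is absorbed because every term of \<open>R\<close> is homogeneous
      of degree \<open>p\<close>: scaling both arguments by \<open>b\<close> produces the factor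
      \<open>b powr p = a i x\<close>.\<close>
    have summand: "a i x * \<bar>vadd n \<xi> \<eta> i\<bar> powr p - a i x * \<bar>\<xi> i\<bar> powr p
          - p * (a i x * \<bar>\<xi> i\<bar> powr (p - 2) * \<xi> i * \<eta> i)
        = R (scaled p a x \<xi> i) (scaled p a x \<eta> i)" if i: "i \<in> {1..n}" for i
    proof -
      have a: "0 < a i x"
        using w x i by (auto simp: weight_vector_def)
      define b where "b = a i x powr (1 / p)"
      have b: "0 < b"
        using a by (simp add: b_def)
      have bp: "b powr p = a i x"
        using a assms by (simp add: b_def powr_powr)
      have bp2: "b powr (p - 2) * b\<^sup>2 = a i x"
        using b by (simp add: powr_diff flip: bp)
      have 1: "\<bar>b * \<xi> i + b * \<eta> i\<bar> powr p = a i x * \<bar>\<xi> i + \<eta> i\<bar> powr p"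
        using b by (simp add: abs_mult powr_mult bp flip: distrib_left)
      have 2: "\<bar>b * \<xi> i\<bar> powr p = a i x * \<bar>\<xi> i\<bar> powr p"
        using b by (simp add: abs_mult powr_mult bp)
      \<comment> \<open>The mixed term collects \<open>b\<close> with exponent \<open>p - 2\<close>
        from the power and one further factor from each of the two components, again
        \<open>b powr p\<close> in total.\<close>
      have "\<bar>b * \<xi> i\<bar> powr (p - 2) * (b * \<xi> i) * (b * \<eta> i)
          = (b powr (p - 2) * b\<^sup>2) * (\<bar>\<xi> i\<bar> powr (p - 2) * \<xi> i * \<eta> i)"
        using b by (simp add: abs_mult powr_mult power2_eq_square)
      then have 3: "\<bar>b * \<xi> i\<bar> powr (p - 2) * (b * \<xi> i) * (b * \<eta> i)
          = a i x * \<bar>\<xi> i\<bar> powr (p - 2) * \<xi> i * \<eta> i"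
        by (simp add: bp2)
      show ?thesis
        using i unfolding R_def scaled_def b_def[symmetric] 1 2 3 by (simp add: vadd_def)
    qed
    have "pa_norm_pow n p a x (vadd n \<xi> \<eta>) - pa_norm_pow n p a x \<xi>
        - p * (\<Sum>i=1..n. a i x * \<bar>\<xi> i\<bar> powr (p - 2) * \<xi> i * \<eta> i)
        = (\<Sum>i=1..n. R (scaled p a x \<xi> i) (scaled p a x \<eta> i))"
      unfolding pa_norm_pow_def sum_distrib_left sum_subtractf[symmetric]
      by (rule sum.cong) (simp_all add: summand)
    then show ?thesis
      unfolding quasi_sum_def sum_distrib_left R_def
      using sum_mono[OF lower] sum_mono[OF upper] by auto
  qed
  with cC show ?thesis
    by (intro exI[of _ c] exI[of _ C]) auto
qed

end
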